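(* Let $(w_j)$ be the $\frac12$-discrete sine process and, for integers $L\ge1$, let $$G_{L/2}=\mathbb{P}\Big[\#_{\{L/2\}}=1,\ \#_{\{1/2,2/2,\dots,(L-1)/2\}}=0\ \Big|\ \#_{\{0\}}=1\Big].$$ Then for all $L\ge1$, $$G_{L/2}=2\big(\omega(L+1)+\omega(L-1)-2\omega(L)\big),$$ where $\omega(0)=1$ and $\omega(L)=\det(I-\tfrac12\Sigma_L)$ for $L\ge1$.
   Context: $S(x)=\frac{\sin\pi x}{\pi x}$ for $x\ne0$, $S(0)=1$. The $\frac12$-discrete sine process is the point process (random locally finite configuration $(w_j)_{j\in\mathbb{Z}}$ of points) supported on $\frac12\mathbb{Z}$ satisfying, for all $n\ge1$ and $\varphi\in C_c(\mathbb{R}^n)$, $\mathbb{E}\sum_{j_1,\dots,j_n\ \text{distinct}}\varphi(w_{j_1},\dots,w_{j_n})=(\tfrac12)^n\sum_{k\in(\frac12\mathbb{Z})^n}\varphi(k)\det_{1\le i,j\le n}[S(k_i-k_j)]$; it exists and is uniquely determined by these correlation functions. For a set $B$, $\#_B$ denotes the number of indices $j$ with $w_j\in B$. For $L\ge1$, $\Sigma_L$ is the $L\times L$ symmetric Toeplitz matrix $(a_{k-j})_{0\le j,k\le L-1}$ with $a_j=S(j/2)$, i.e. $a_0=1$, $a_j=0$ for nonzero even $j$, and $a_j=\frac{2(-1)^{(|j|-1)/2}}{\pi|j|}$ for odd $j$; $I$ is the $L\times L$ identity matrix. (The quantity $G_{L/2}$ equals the probability that a randomly chosen gap in the Alternative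 Hypothesis point process, i.e. the $\frac12$-discrete sine process translated by an independent uniform random variable on $[0,\frac12)$, has size $L/2$.) *)

theory Defs
  imports "HOL-Probability.Probability" "Jordan_Normal_Form.Determinant"
begin

definition sine_kernel :: "real \<Rightarrow> real" where
  "sine_kernel x = (if x = 0 then 1 else sin (pi * x) / (pi * x))"

definition half_integers :: "real set" where
  "half_integers = range (\<lambda>m::int. real_of_int m / 2)"

text \<open>
  Since the dimension \<open>n\<close> is quantified inside the definition of the process, \<open>\<real>\<^sup>n\<close> is
  rendered as \<^const>\<open>Euclidean_space\<close> \<open>n\<close>, whose points are the sequences vanishing from index
  \<open>n\<close> on. Only the values of a test function on that space matter.
\<close>

definition compactly_supported_continuous :: "nat \<Rightarrow> ((nat \<Rightarrow> real) \<Rightarrow> real) \<Rightarrow> bool" where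
  "compactly_supported_continuous n \<phi> \<longleftrightarrow>
     continuous_map (Euclidean_space n) euclideanreal \<phi> \<and>
     compactin (Euclidean_space n)
       (Euclidean_space n closure_of {x \<in> topspace (Euclidean_space n). \<phi> x \<noteq> 0})"

definition half_integer_points :: "nat \<Rightarrow> (nat \<Rightarrow> real) set" where
  "half_integer_points n = {k \<in> topspace (Euclidean_space n). \<forall>i<n. k i \<in> half_integers}"

definition distinct_tuples :: "nat \<Rightarrow> (nat \<Rightarrow> int) set" where
  "distinct_tuples n = {js \<in> {..<n} \<rightarrow>\<^sub>E UNIV. inj_on js {..<n}}"

text \<open>
  For almost every outcome, local finiteness and the compact support of \<open>\<phi>\<close> leave only finitely
  many nonzero terms in each \<^const>\<open>infsum\<close> below.
\<close>

definition tuple_sum ::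
  "(int \<Rightarrow> 'a \<Rightarrow> real) \<Rightarrow> nat \<Rightarrow> ((nat \<Rightarrow> real) \<Rightarrow> real) \<Rightarrow> 'a \<Rightarrow> real" where
  "tuple_sum w n \<phi> x =
     (\<Sum>\<^sub>\<infinity>js\<in>distinct_tuples n. \<phi> (\<lambda>i. if i < n then w (js i) x else 0))"

locale half_discrete_sine_process = prob_space M
  for M :: "'a measure" +
  fixes w :: "int \<Rightarrow> 'a \<Rightarrow> real"
  assumes measurable_points: "\<And>j. w j \<in> borel_measurable M"
    and locally_finite: "AE x in M. \<forall>K. compact K \<longrightarrow> finite {j. w j x \<in> K}"
    and supported: "AE x in M. \<forall>j. w j x \<in> half_integers"
    and integrable_tuple_sum:
      "\<And>n \<phi>. \<lbrakk>n \<ge> 1; compactly_supported_continuous n \<phi>\<rbrakk> \<Longrightarrow> integrable M (tuple_sum w n \<phi>)"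
    and correlation:
      "\<And>n \<phi>. \<lbrakk>n \<ge> 1; compactly_supported_continuous n \<phi>\<rbrakk> \<Longrightarrow>
         expectation (tuple_sum w n \<phi>) =
         (1 / 2) ^ n * (\<Sum>\<^sub>\<infinity>k\<in>half_integer_points n.
           \<phi> k * Determinant.det (Matrix.mat n n (\<lambda>(i, j). sine_kernel (k i - k j))))"

definition num_points :: "(int \<Rightarrow> 'a \<Rightarrow> real) \<Rightarrow> real set \<Rightarrow> 'a \<Rightarrow> nat" where
  "num_points w B x = card {j. w j x \<in> B}"

definition gap_prob :: "'a measure \<Rightarrow> (int \<Rightarrow> 'a \<Rightarrow> real) \<Rightarrow> nat \<Rightarrow> real" where
  "gap_prob M w L =
     \<P>(x in M. num_points w {real L / 2} x = 1 \<and>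
                num_points w ((\<lambda>k. real k / 2) ` {1..<L}) x = 0
              \<bar> num_points w {0} x = 1)"

definition toeplitz_coeff :: "int \<Rightarrow> real" where
  "toeplitz_coeff j = sine_kernel (real_of_int j / 2)"

definition Sigma_mat :: "nat \<Rightarrow> real Matrix.mat" where
  "Sigma_mat L = Matrix.mat L L (\<lambda>(j, k). toeplitz_coeff (int k - int j))"

definition omega :: "nat \<Rightarrow> real" where
  "omega L = (if L = 0 then 1
              else Determinant.det (1\<^sub>m L - (1 / 2) \<cdot>\<^sub>m Sigma_mat L))"

end

theory Submission
  imports Defs
begin

text \<open>
  Testing the correlation identity against a product of tent functions centred at half-integers
  \<open>b 0, \<dots>, b (n - 1)\<close> isolates a single term on each side. For two equal centres the determinant
  vanishes, so the process is almost surely simple. For distinct centres, with \<open>X b\<close> the indicator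
  that \<open>b\<close> is occupied, the identity reads \<open>E (\<Prod>i<n. X (b i)) = det (K (b i) (b j))\<close>, where
  \<open>K x y = sine_kernel (x - y) / 2\<close>.

  Replacing a factor \<open>X (b m)\<close> by \<open>1 - X (b m)\<close> replaces row \<open>m\<close> of \<open>K\<close> by row \<open>m\<close> of \<open>I - K\<close>, as
  Laplace expansion along that row shows. In particular \<open>omega L\<close> is the probability that \<open>L\<close>
  consecutive half-integers are all empty, and expanding
  \<open>X 0 * X (L/2) = (1 - (1 - X 0)) * (1 - (1 - X (L/2)))\<close> gives the second difference of \<open>omega\<close>.
\<close>

text \<open>Takes only the values 0 and 1 at every outcome, whereas \<open>num_points\<close> at a
  single point does so only almost surely. Products of such factors are therefore bounded.\<close>

definition occupied :: "(int \<Rightarrow> 'a \<Rightarrow> real) \<Rightarrow> real \<Rightarrow> 'a \<Rightarrow> real" where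
  "occupied w b x = of_bool (\<exists>j. w j x = b)"

text \<open>A continuous substitute for a point mass: each tent has half-width 1/2, the spacing of
  the lattice, so it is 1 at its centre and 0 at all other half-integers.\<close>

definition tent_product :: "nat \<Rightarrow> (nat \<Rightarrow> real) \<Rightarrow> (nat \<Rightarrow> real) \<Rightarrow> real" where
  "tent_product n b x = (\<Prod>i<n. max 0 (1 - 2 * \<bar>x i - b i\<bar>))"

text \<open>For the kernel of the process this is the probability that the first \<open>m\<close> of
  \<open>n\<close> sites are occupied and the rest empty, see
  \<open>expectation_occupied_pattern\<close>.\<close>

definition mixed_det :: "nat \<Rightarrow> nat \<Rightarrow> (nat \<Rightarrow> nat \<Rightarrow> real) \<Rightarrow> real" where
  "mixed_det m n K =
     Determinant.det (Matrix.mat n n (\<lambda>(i, j). if i < m then K i j else of_bool (i = j) - K i j))"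

section \<open>Row recursion for mixed determinants\<close>

lemma mixed_det_cong:
  assumes "\<And>i j. i < n \<Longrightarrow> j < n \<Longrightarrow> K i j = K' i j"
  shows "mixed_det m n K = mixed_det m n K'"
  unfolding mixed_det_def by (rule arg_cong[where f = Determinant.det]) (rule eq_matI, use assms in auto)

text \<open>The matrices for \<open>m\<close> and \<open>Suc m\<close> differ only in row
  \<open>m\<close>, where one is the unit row minus the other, so their cofactors along that row
  agree. The unit row contributes the diagonal cofactor, a mixed determinant with index
  \<open>m\<close> skipped by \<open>insert_index m\<close>.\<close>

lemma mixed_det_expand:
  assumes "m \<le> n"
  shows "mixed_det m (Suc n) K =
    mixed_det m n (\<lambda>i j. K (insert_index m i) (insert_index m j)) - mixed_det (Suc m) (Suc n) K"
proof -
  let ?mat = "\<lambda>m. Matrix.mat (Suc n) (Suc n) (\<lambda>(i, j). if i < m then K i j else of_bool (i = j) - K i j)"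
  define A where "A = ?mat m"
  define B where "B = ?mat (Suc m)"
  have m: "m < Suc n" using assms by simp
  have carrier: "A \<in> carrier_mat (Suc n) (Suc n)" "B \<in> carrier_mat (Suc n) (Suc n)"
    by (auto simp: A_def B_def)
  have "mat_delete A m j = mat_delete B m j" for j
    by (rule eq_matI) (auto simp: A_def B_def mat_delete_def)
  hence cofactor: "cofactor A m j = cofactor B m j" for j
    by (simp add: cofactor_def)
  have "mat_delete A m m = Matrix.mat n n (\<lambda>(i, j). if i < m then K (insert_index m i) (insert_index m j)
      else of_bool (i = j) - K (insert_index m i) (insert_index m j))"
    by (rule eq_matI) (auto simp: A_def mat_delete_def insert_index_def)
  hence minor: "cofactor A m m = mixed_det m n (\<lambda>i j. K (insert_index m i) (insert_index m j))"
    by (simp add: cofactor_def mixed_det_def)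
  have row: "A $$ (m, j) = of_bool (m = j) - B $$ (m, j)" if "j < Suc n" for j
    using that m by (simp add: A_def B_def)
  have "mixed_det m (Suc n) K = (\<Sum>j<Suc n. A $$ (m, j) * cofactor A m j)"
    using laplace_expansion_row[OF carrier(1) m] by (simp add: mixed_det_def A_def)
  also have "\<dots> = (\<Sum>j<Suc n. (if m = j then cofactor A m j else 0) - B $$ (m, j) * cofactor B m j)"
    by (rule sum.cong) (auto simp: row cofactor left_diff_distrib)
  also have "\<dots> = cofactor A m m - (\<Sum>j<Suc n. B $$ (m, j) * cofactor B m j)"
    unfolding sum_subtractf using m by (simp add: sum.delta' del: sum.lessThan_Suc)
  also have "(\<Sum>j<Suc n. B $$ (m, j) * cofactor B m j) = mixed_det (Suc m) (Suc n) K"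
    using laplace_expansion_row[OF carrier(2) m] by (simp add: mixed_det_def B_def)
  finally show ?thesis using minor by simp
qed

section \<open>Tent functions on the half-integer lattice\<close>

lemma tent_half_integers:
  assumes "s \<in> half_integers" "t \<in> half_integers"
  shows "max 0 (1 - 2 * \<bar>s - t\<bar>) = (of_bool (s = t) :: real)"
proof -
  obtain p q :: int where pq: "s = p / 2" "t = q / 2"
    using assms by (auto simp: half_integers_def)
  have "\<bar>p / 2 - q / 2\<bar> \<ge> (1 / 2 :: real)" if "p \<noteq> q"
  proof -
    have "\<bar>p - q\<bar> \<ge> 1" using that by simp
    hence "\<bar>real_of_int p - real_of_int q\<bar> \<ge> 1"
      by linarith
    thus ?thesis by (simp add: diff_divide_distrib[symmetric])
  qed
  thus ?thesis unfolding pq by (cases "p = q") auto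
qed

lemma tent_product_half_integers:
  assumes "\<And>i. i < n \<Longrightarrow> x i \<in> half_integers" "\<And>i. i < n \<Longrightarrow> b i \<in> half_integers"
  shows "tent_product n b x = of_bool (\<forall>i<n. x i = b i)"
proof -
  have "tent_product n b x = (\<Prod>i<n. of_bool (x i = b i))"
    unfolding tent_product_def by (rule prod.cong) (use assms in \<open>auto simp: tent_half_integers\<close>)
  also have "\<dots> = of_bool (\<forall>i<n. x i = b i)"
    by (cases "\<forall>i<n. x i = b i") (auto simp: prod_zero_iff)
  finally show ?thesis .
qed

lemma compactly_supported_continuous_tent_product:
  "compactly_supported_continuous n (tent_product n b)"
proof -
  let ?E = "Euclidean_space n"
  let ?S = "{x \<in> topspace ?E. tent_product n b x \<noteq> 0}"
  \<comment> \<open>A closed box around \<open>b\<close>, with the coordinates from \<open>n\<close>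
    on pinned to 0 so that it lies in \<open>Euclidean_space n\<close>. It is compact as a product
    of compact sets, and closed because the space is Hausdorff, so it contains the closure of the
    support.\<close>
  define C where "C = (\<Pi>\<^sub>E i\<in>UNIV. if i < n then {b i - 1/2 .. b i + 1/2} else {0})"
  have "continuous_map ?E euclideanreal (\<lambda>x. x i)" for i
    unfolding Euclidean_space_def
    by (intro continuous_map_from_subtopology continuous_map_product_projection) auto
  hence cont: "continuous_map ?E euclideanreal (tent_product n b)"
    unfolding tent_product_def by (intro continuous_intros) auto
  have "compactin (powertop_real UNIV) C"
    unfolding C_def compactin_PiE by (intro disjI2) auto
  moreover have "C \<subseteq> {x. \<forall>i\<ge>n. x i = 0}"
  proof (intro subsetI CollectI allI impI)
    fix x i assume "x \<in> C" "n \<le> i"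
    thus "x i = 0" unfolding C_def PiE_iff by (metis UNIV_I linorder_not_less singletonD)
  qed
  ultimately have comp: "compactin ?E C"
    unfolding Euclidean_space_def compactin_subtopology by simp
  have "x \<in> C" if "x \<in> ?S" for x
  proof -
    have "\<bar>x i - b i\<bar> < 1/2" if "i < n" for i
    proof (rule ccontr)
      assume "\<not> \<bar>x i - b i\<bar> < 1/2"
      hence "tent_product n b x = 0"
        unfolding tent_product_def by (intro prod_zero bexI[of _ i]) (use that in auto)
      thus False using \<open>x \<in> ?S\<close> by simp
    qed
    hence "x i \<in> {b i - 1/2 .. b i + 1/2}" if "i < n" for i
      unfolding atLeastAtMost_iff using that by (smt (verit))
    moreover have "x i = 0" if "\<not> i < n" for i
      using \<open>x \<in> ?S\<close> that by (simp add: topspace_Euclidean_space)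
    ultimately show ?thesis by (simp add: C_def PiE_iff)
  qed
  hence "?E closure_of ?S \<subseteq> C"
    by (intro closure_of_minimal compactin_imp_closedin Hausdorff_Euclidean_space comp) auto
  with comp have "compactin ?E (?E closure_of ?S)"
    by (rule closed_compactin) (rule closedin_closure_of)
  with cont show ?thesis by (simp add: compactly_supported_continuous_def)
qed

lemma sum_tent_product_half_integer_points:
  assumes "\<And>i. i < n \<Longrightarrow> b i \<in> half_integers"
  shows "(\<Sum>\<^sub>\<infinity>k\<in>half_integer_points n.
           tent_product n b k * Determinant.det (Matrix.mat n n (\<lambda>(i, j). S (k i - k j)))) =
         Determinant.det (Matrix.mat n n (\<lambda>(i, j). S (b i - b j)))" (is "infsum ?f _ = ?d")
proof -
  \<comment> \<open>Points of \<open>half_integer_points n\<close> vanish from index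
    \<open>n\<close> on, but \<open>b\<close> is arbitrary there, so it has to be truncated.\<close>
  define b' where "b' = (\<lambda>i. if i < n then b i else 0)"
  have b': "b' \<in> half_integer_points n"
    using assms by (auto simp: b'_def half_integer_points_def topspace_Euclidean_space)
  have tent: "tent_product n b k = of_bool (k = b')" if "k \<in> half_integer_points n" for k
  proof -
    have "tent_product n b k = of_bool (\<forall>i<n. k i = b i)"
      by (rule tent_product_half_integers)
         (use that assms in \<open>auto simp: half_integer_points_def\<close>)
    also have "(\<forall>i<n. k i = b i) \<longleftrightarrow> k = b'"
      using that by (auto simp: b'_def half_integer_points_def topspace_Euclidean_space fun_eq_iff)
    finally show ?thesis .
  qed
  have "infsum ?f (half_integer_points n) = infsum ?f {b'}"
    by (rule infsum_cong_neutral) (use b' in \<open>auto simp: tent\<close>)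
  also have "\<dots> = Determinant.det (Matrix.mat n n (\<lambda>(i, j). S (b' i - b' j)))"
    using b' by (simp add: tent)
  also have "Matrix.mat n n (\<lambda>(i, j). S (b' i - b' j)) = Matrix.mat n n (\<lambda>(i, j). S (b i - b j))"
    by (rule eq_matI) (auto simp: b'_def)
  finally show ?thesis .
qed

section \<open>The Toeplitz determinant as a mixed determinant\<close>

lemma sine_kernel_minus: "sine_kernel (- x) = sine_kernel x"
  by (simp add: sine_kernel_def)

lemma omega_eq_mixed_det:
  "omega n = mixed_det 0 n (\<lambda>i j. sine_kernel (real i / 2 - real j / 2) / 2)"
proof (cases "n = 0")
  case False
  let ?A = "Matrix.mat n n (\<lambda>(i, j). if i < 0 then sine_kernel (real i / 2 - real j / 2) / 2
      else of_bool (i = j) - sine_kernel (real i / 2 - real j / 2) / 2)"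
  have "1\<^sub>m n - (1 / 2) \<cdot>\<^sub>m Sigma_mat n = ?A"
  proof (rule eq_matI)
    fix i j assume "i < dim_row ?A" "j < dim_col ?A"
    \<comment> \<open>\<open>Sigma_mat\<close> uses column minus row, the correlation kernel row
      minus column; evenness of the kernel reconciles them.\<close>
    moreover have "sine_kernel (real j / 2 - real i / 2) = sine_kernel (real i / 2 - real j / 2)"
      using sine_kernel_minus[of "real i / 2 - real j / 2"] by simp
    ultimately show "(1\<^sub>m n - (1 / 2) \<cdot>\<^sub>m Sigma_mat n) $$ (i, j) = ?A $$ (i, j)"
      by (simp add: Sigma_mat_def toeplitz_coeff_def diff_divide_distrib)
  qed (auto simp: Sigma_mat_def)
  with False show ?thesis by (simp add: omega_def mixed_det_def)
qed (simp add: omega_def mixed_det_def)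

text \<open>Expresses finiteness by quantifiers over the integers, which are countable; this makes
  events about \<open>card\<close> measurable.\<close>

lemma finite_int_set_iff_bounded: "finite (A :: int set) \<longleftrightarrow> (\<exists>n. \<forall>j. j \<in> A \<longrightarrow> \<bar>j\<bar> \<le> n)"
proof
  assume "finite A"
  hence "\<forall>j. j \<in> A \<longrightarrow> \<bar>j\<bar> \<le> (\<Sum>i\<in>A. \<bar>i\<bar>)"
    by (auto intro: member_le_sum)
  thus "\<exists>n. \<forall>j. j \<in> A \<longrightarrow> \<bar>j\<bar> \<le> n" by blast
next
  assume "\<exists>n. \<forall>j. j \<in> A \<longrightarrow> \<bar>j\<bar> \<le> n"
  then obtain n where "A \<subseteq> {-n..n}" by (force simp: abs_le_iff)
  thus "finite A" by (rule finite_subset) simp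
qed

section \<open>From correlation functions to occupation probabilities\<close>

context half_discrete_sine_process
begin

lemma occupied_measurable [measurable]: "occupied w b \<in> borel_measurable M"
proof -
  note measurable_points[measurable]
  show ?thesis unfolding occupied_def by measurable
qed

lemma integrable_bounded_by_1:
  assumes "f \<in> borel_measurable M" "\<And>x. \<bar>f x\<bar> \<le> (1 :: real)"
  shows "integrable M f"
  by (rule integrable_const_bound[where B = 1]) (use assms in auto)

text \<open>Finiteness comes from local finiteness at the singletons of the centres. It is recorded
  with the count because a zero \<open>card\<close> alone would not show that the set is
  empty.\<close>

lemma tuple_sum_tent_product:
  assumes b: "\<And>i. i < n \<Longrightarrow> b i \<in> half_integers"
  shows "AE x in M. finite {js \<in> distinct_tuples n. \<forall>i<n. w (js i) x = b i} \<and>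
    tuple_sum w n (tent_product n b) x =
      real (card {js \<in> distinct_tuples n. \<forall>i<n. w (js i) x = b i})"
  using locally_finite supported
proof eventually_elim
  case (elim x)
  let ?T = "{js \<in> distinct_tuples n. \<forall>i<n. w (js i) x = b i}"
  have "?T \<subseteq> (\<Pi>\<^sub>E i\<in>{..<n}. {j. w j x \<in> {b i}})"
    by (auto simp: distinct_tuples_def PiE_def)
  moreover have "finite \<dots>"
    by (intro finite_PiE elim(1)[rule_format]) simp_all
  ultimately have fin: "finite ?T" by (rule finite_subset)
  have tent: "tent_product n b (\<lambda>i. if i < n then w (js i) x else 0) =
      of_bool (\<forall>i<n. w (js i) x = b i)" for js
    by (subst tent_product_half_integers) (use elim b in auto)
  have "tuple_sum w n (tent_product n b) x = infsum (\<lambda>_. 1) ?T"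
    unfolding tuple_sum_def by (rule infsum_cong_neutral) (auto simp: tent)
  with fin show ?case by simp
qed

lemma expectation_tuple_sum_tent_product:
  assumes "n \<ge> 1" "\<And>i. i < n \<Longrightarrow> b i \<in> half_integers"
  shows "expectation (tuple_sum w n (tent_product n b)) =
    (1 / 2) ^ n * Determinant.det (Matrix.mat n n (\<lambda>(i, j). sine_kernel (b i - b j)))"
  using correlation[OF assms(1) compactly_supported_continuous_tent_product]
    sum_tent_product_half_integer_points[OF assms(2), where S = sine_kernel] by simp

text \<open>With both centres at \<open>c\<close> the determinant has two equal rows, so the
  nonnegative number of ordered pairs of distinct indices at \<open>c\<close> has expectation 0 and
  vanishes almost surely.\<close>

lemma AE_simple_at:
  assumes c: "c \<in> half_integers"
  shows "AE x in M. \<forall>i j. w i x = c \<longrightarrow> w j x = c \<longrightarrow> i = j"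
proof -
  let ?b = "\<lambda>_::nat. c"
  let ?T = "\<lambda>x. {js \<in> distinct_tuples 2. \<forall>i<2. w (js i) x = c}"
  note ae = tuple_sum_tent_product[of 2 ?b, OF c]
  have "Determinant.det (Matrix.mat 2 2 (\<lambda>(i, j). sine_kernel (?b i - ?b j))) = 0"
    by (rule det_identical_rows[of _ 2 0 1]) auto
  hence "expectation (tuple_sum w 2 (tent_product 2 ?b)) = 0"
    by (simp add: expectation_tuple_sum_tent_product c)
  moreover have "integrable M (tuple_sum w 2 (tent_product 2 ?b))"
    by (rule integrable_tuple_sum) (auto simp: compactly_supported_continuous_tent_product)
  moreover have "AE x in M. 0 \<le> tuple_sum w 2 (tent_product 2 ?b) x"
    using ae by eventually_elim simp
  ultimately have "AE x in M. tuple_sum w 2 (tent_product 2 ?b) x = 0"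
    by (simp add: integral_nonneg_eq_0_iff_AE)
  with ae show ?thesis
  proof eventually_elim
    case (elim x)
    hence empty: "?T x = {}" by (metis (no_types, lifting) card_0_eq of_nat_eq_0_iff)
    show ?case
    proof (intro allI impI, rule ccontr)
      fix i j assume ij: "w i x = c" "w j x = c" "i \<noteq> j"
      have "(\<lambda>k\<in>{..<2::nat}. if k = 0 then i else j) \<in> ?T x"
        using ij by (auto simp: distinct_tuples_def inj_on_def less_2_cases_iff)
      with empty show False by blast
    qed
  qed
qed

lemma num_points_singleton_AE:
  assumes "c \<in> half_integers"
  shows "AE x in M. real (num_points w {c} x) = occupied w c x"
  using AE_simple_at[OF assms]
proof eventually_elim
  case (elim x)
  show ?case
  proof (cases "\<exists>j. w j x = c")
    case True
    then obtain j where "{j. w j x = c} = {j}" using elim by blast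
    thus ?thesis using True by (simp add: num_points_def occupied_def)
  qed (simp add: num_points_def occupied_def)
qed

text \<open>Local finiteness is what excludes infinitely many points in \<open>B\<close>, for which
  \<open>card\<close> would also give 0.\<close>

lemma num_points_finite_AE:
  assumes "finite B"
  shows "AE x in M. num_points w B x = 0 \<longleftrightarrow> (\<forall>c\<in>B. occupied w c x = 0)"
  using locally_finite
proof eventually_elim
  case (elim x)
  hence "finite {j. w j x \<in> B}" using finite_imp_compact[OF assms] by blast
  thus ?case by (auto simp: num_points_def occupied_def)
qed

lemma expectation_prod_occupied:
  assumes b: "\<And>i. i < n \<Longrightarrow> b i \<in> half_integers" and inj: "inj_on b {..<n}"
  shows "expectation (\<lambda>x. \<Prod>i<n. occupied w (b i) x) =
    Determinant.det (Matrix.mat n n (\<lambda>(i, j). sine_kernel (b i - b j) / 2))"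
proof (cases "n = 0")
  \<comment> \<open>The correlation identity starts at \<open>n = 1\<close>; here the empty product
    and the empty determinant are both 1.\<close>
  case True
  thus ?thesis by (simp add: prob_space)
next
  case False
  have "AE x in M. \<forall>i\<in>{..<n}. real (num_points w {b i} x) = occupied w (b i) x"
    by (rule AE_finite_allI) (auto intro: num_points_singleton_AE b)
  moreover have "AE x in M. finite {js \<in> distinct_tuples n. \<forall>i<n. w (js i) x = b i} \<and>
      tuple_sum w n (tent_product n b) x =
        real (card {js \<in> distinct_tuples n. \<forall>i<n. w (js i) x = b i})"
    by (rule tuple_sum_tent_product[OF b])
  ultimately have "AE x in M. (\<Prod>i<n. occupied w (b i) x) = tuple_sum w n (tent_product n b) x"
  proof eventually_elim
    case (elim x)
    \<comment> \<open>Distinct centres force distinct indices, so the tuples form a full product,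
      and their number is the product of the \<open>num_points\<close> at the centres.\<close>
    have "{js \<in> distinct_tuples n. \<forall>i<n. w (js i) x = b i} = (\<Pi>\<^sub>E i\<in>{..<n}. {j. w j x \<in> {b i}})"
    proof (intro equalityI subsetI)
      fix js assume js: "js \<in> (\<Pi>\<^sub>E i\<in>{..<n}. {j. w j x \<in> {b i}})"
      have "inj_on js {..<n}"
      proof (rule inj_onI)
        fix i k assume "i \<in> {..<n}" "k \<in> {..<n}" "js i = js k"
        moreover from this have "js i \<in> {j. w j x \<in> {b i}}" "js k \<in> {j. w j x \<in> {b k}}"
          using PiE_mem[OF js] by blast+
        ultimately have "b i = b k" by simp
        thus "i = k" using inj \<open>i \<in> _\<close> \<open>k \<in> _\<close> by (simp add: inj_on_def)
      qed
      thus "js \<in> {js \<in> distinct_tuples n. \<forall>i<n. w (js i) x = b i}"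
        using js by (auto simp: distinct_tuples_def PiE_iff)
    qed (auto simp: distinct_tuples_def PiE_iff)
    with elim show ?case by (simp add: card_PiE num_points_def)
  qed
  hence "expectation (\<lambda>x. \<Prod>i<n. occupied w (b i) x) =
      expectation (tuple_sum w n (tent_product n b))"
    using False integrable_tuple_sum[of n "tent_product n b"]
    by (intro integral_cong_AE) (auto simp: compactly_supported_continuous_tent_product)
  also have "\<dots> = Determinant.det ((1 / 2) \<cdot>\<^sub>m Matrix.mat n n (\<lambda>(i, j). sine_kernel (b i - b j)))"
    using False b by (simp add: expectation_tuple_sum_tent_product)
  also have "(1 / 2) \<cdot>\<^sub>m Matrix.mat n n (\<lambda>(i, j). sine_kernel (b i - b j)) =
      Matrix.mat n n (\<lambda>(i, j). sine_kernel (b i - b j) / 2)"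
    by (rule eq_matI) auto
  finally show ?thesis .
qed

section \<open>Patterns of occupied and empty sites\<close>

lemma occupied_pattern_measurable [measurable]:
  "(\<lambda>x. (\<Prod>i\<in>A. occupied w (f i) x) * (\<Prod>i\<in>B. 1 - occupied w (g i) x)) \<in> borel_measurable M"
  by measurable

lemma integrable_occupied_pattern:
  "integrable M (\<lambda>x. (\<Prod>i\<in>A. occupied w (f i) x) * (\<Prod>i\<in>B. 1 - occupied w (g i) x))"
proof (rule integrable_bounded_by_1)
  fix x
  have "\<bar>\<Prod>i\<in>A. occupied w (f i) x\<bar> \<le> 1" "\<bar>\<Prod>i\<in>B. 1 - occupied w (g i) x\<bar> \<le> 1"
    unfolding abs_prod by (rule prod_le_1; auto simp: occupied_def)+
  thus "\<bar>(\<Prod>i\<in>A. occupied w (f i) x) * (\<Prod>i\<in>B. 1 - occupied w (g i) x)\<bar> \<le> 1"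
    unfolding abs_mult by (intro mult_le_one) auto
qed measurable

text \<open>Both sides obey the recursion of \<open>mixed_det_expand\<close>. The induction is on
  the number \<open>n - m\<close> of empty sites: writing the factor of site \<open>m\<close> as 1
  minus its indicator either drops the site or makes it occupied, and both patterns have one empty
  site fewer.\<close>

lemma expectation_occupied_pattern:
  assumes "m \<le> n" "\<And>i. i < n \<Longrightarrow> b i \<in> half_integers" "inj_on b {..<n}"
  shows "expectation (\<lambda>x. (\<Prod>i<m. occupied w (b i) x) * (\<Prod>i\<in>{m..<n}. 1 - occupied w (b i) x)) =
    mixed_det m n (\<lambda>i j. sine_kernel (b i - b j) / 2)"
  using assms
proof (induction "n - m" arbitrary: m n b)
  case 0
  hence "n = m" by simp
  moreover have "Matrix.mat n n (\<lambda>(i, j). if i < n then sine_kernel (b i - b j) / 2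
        else of_bool (i = j) - sine_kernel (b i - b j) / 2) =
      Matrix.mat n n (\<lambda>(i, j). sine_kernel (b i - b j) / 2)"
    by (rule eq_matI) auto
  ultimately show ?case
    using 0 by (simp add: mixed_det_def expectation_prod_occupied)
next
  case (Suc k)
  then obtain n' where n: "n = Suc n'" by (cases n) auto
  have m: "m \<le> n'" using Suc n by simp
  let ?c = "\<lambda>i. b (insert_index m i)"
  let ?P = "\<lambda>m n b x. (\<Prod>i<m. occupied w (b i) x) * (\<Prod>i\<in>{m..<n}. 1 - occupied w (b i) x)"
  have c: "?c i \<in> half_integers" if "i < n'" for i
    using that n Suc.prems(2) by (simp add: insert_index_def)
  have inj_c: "inj_on ?c {..<n'}"
  proof (rule inj_onI)
    fix i j assume "i \<in> {..<n'}" "j \<in> {..<n'}" "?c i = ?c j"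
    hence "insert_index m i = insert_index m j"
      using n by (intro inj_onD[OF Suc.prems(3)]) (auto simp: insert_index_def)
    thus "i = j" by (metis delete_insert_index)
  qed
  have "?P m n b x = ?P m n' ?c x - ?P (Suc m) n b x" for x
  proof -
    have "(\<Prod>i\<in>{m..<n'}. 1 - occupied w (?c i) x) = (\<Prod>i\<in>{m..<n'}. 1 - occupied w (b (Suc i)) x)"
      by (rule prod.cong) auto
    also have "\<dots> = (\<Prod>i\<in>{Suc m..<n}. 1 - occupied w (b i) x)"
      unfolding n by (rule prod.shift_bounds_Suc_ivl[symmetric])
    finally have "(\<Prod>i\<in>{m..<n'}. 1 - occupied w (?c i) x) =
        (\<Prod>i\<in>{Suc m..<n}. 1 - occupied w (b i) x)" .
    moreover have "(\<Prod>i<m. occupied w (?c i) x) = (\<Prod>i<m. occupied w (b i) x)"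
      by (rule prod.cong) auto
    moreover have "(\<Prod>i\<in>{m..<n}. 1 - occupied w (b i) x) =
        (1 - occupied w (b m) x) * (\<Prod>i\<in>{Suc m..<n}. 1 - occupied w (b i) x)"
      using m n by (intro prod.atLeast_Suc_lessThan) auto
    ultimately show ?thesis by (simp only: prod.lessThan_Suc) (simp only: algebra_simps)
  qed
  hence "expectation (?P m n b) = expectation (?P m n' ?c) - expectation (?P (Suc m) n b)"
    by (simp add: integrable_occupied_pattern del: prod.lessThan_Suc)
  also have "expectation (?P m n' ?c) = mixed_det m n' (\<lambda>i j. sine_kernel (?c i - ?c j) / 2)"
    by (rule Suc.hyps(1)) (use Suc.hyps(2) m n c inj_c in auto)
  also have "expectation (?P (Suc m) n b) = mixed_det (Suc m) n (\<lambda>i j. sine_kernel (b i - b j) / 2)"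
    by (rule Suc.hyps(1)) (use Suc.hyps(2) m n Suc.prems in auto)
  finally show ?case
    unfolding n by (simp only: mixed_det_expand[OF m])
qed

text \<open>The kernel depends only on differences of sites, so the starting point \<open>s\<close>
  drops out.\<close>

lemma expectation_empty_interval:
  "expectation (\<lambda>x. \<Prod>i\<in>{s..<s + n}. 1 - occupied w (real i / 2) x) = omega n"
proof -
  let ?b = "\<lambda>i. real (i + s) / 2"
  have b: "?b i \<in> half_integers" for i
    unfolding half_integers_def by (rule range_eqI[of _ _ "int (i + s)"]) simp
  have "(\<Prod>i\<in>{s..<s + n}. 1 - occupied w (real i / 2) x) = (\<Prod>i\<in>{0..<n}. 1 - occupied w (?b i) x)" for x
    using prod.shift_bounds_nat_ivl[of "\<lambda>i. 1 - occupied w (real i / 2) x" 0 s n]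
    by (simp add: add.commute)
  hence "expectation (\<lambda>x. \<Prod>i\<in>{s..<s + n}. 1 - occupied w (real i / 2) x) =
      mixed_det 0 n (\<lambda>i j. sine_kernel (?b i - ?b j) / 2)"
    using expectation_occupied_pattern[of 0 n ?b] b by (simp add: inj_on_def)
  also have "\<dots> = omega n"
    unfolding omega_eq_mixed_det by (rule mixed_det_cong) (simp add: diff_divide_distrib add_divide_distrib)
  finally show ?thesis .
qed

section \<open>The gap event and the conditioning event\<close>

lemma num_points_eq_measurable:
  assumes "B \<in> sets borel"
  shows "Measurable.pred M (\<lambda>x. num_points w B x = 1)" "Measurable.pred M (\<lambda>x. num_points w B x = 0)"
proof -
  note measurable_points[measurable] assms[measurable]
  have "num_points w B x = 1 \<longleftrightarrow> (\<exists>j. \<forall>i. w i x \<in> B \<longleftrightarrow> i = j)" for x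
    by (auto simp: num_points_def card_1_singleton_iff set_eq_iff)
  thus "Measurable.pred M (\<lambda>x. num_points w B x = 1)" by simp
  \<comment> \<open>The second disjunct says that infinitely many points lie in \<open>B\<close>,
    where \<open>card\<close> defaults to 0.\<close>
  have "num_points w B x = 0 \<longleftrightarrow>
      (\<forall>i. w i x \<notin> B) \<or> \<not> (\<exists>n. \<forall>j. w j x \<in> B \<longrightarrow> \<bar>j\<bar> \<le> n)" for x
    using finite_int_set_iff_bounded[of "{j. w j x \<in> B}"]
    by (auto simp: num_points_def card_eq_0_iff)
  thus "Measurable.pred M (\<lambda>x. num_points w B x = 0)" by simp
qed

lemma prob_num_points_zero: "\<P>(x in M. num_points w {0} x = 1) = 1 / 2"
proof -
  have z: "0 \<in> half_integers" unfolding half_integers_def by (rule range_eqI[of _ _ 0]) simp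
  have "\<P>(x in M. num_points w {0} x = 1) = expectation (indicator {x \<in> space M. num_points w {0} x = 1})"
    by (auto intro!: arg_cong[where f = prob])
  \<comment> \<open>A product with one factor, so that \<open>expectation_prod_occupied\<close>
    applies with a 1 by 1 determinant.\<close>
  also have "\<dots> = expectation (\<lambda>x. \<Prod>i<1::nat. occupied w ((\<lambda>_. 0) i) x)"
  proof (rule integral_cong_AE)
    show "AE x in M. indicator {x \<in> space M. num_points w {0} x = 1} x =
        (\<Prod>i<1::nat. occupied w ((\<lambda>_. 0) i) x)"
      using num_points_singleton_AE[OF z] AE_space
    proof eventually_elim
      case (elim x)
      thus ?case by (cases "\<exists>j. w j x = 0") (simp_all add: occupied_def indicator_def)
    qed
  qed (use num_points_eq_measurable(1)[of "{0}"] in \<open>auto simp: pred_def\<close>)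
  also have "\<dots> = Determinant.det (Matrix.mat 1 1 (\<lambda>(i, j). sine_kernel (0 - 0) / 2))"
    by (subst expectation_prod_occupied) (auto simp: z inj_on_def)
  also have "\<dots> = 1 / 2"
    by (subst det_single) (auto simp: sine_kernel_def)
  finally show ?thesis .
qed

lemma prob_gap:
  assumes "L \<ge> 1"
  shows "\<P>(x in M. (num_points w {real L / 2} x = 1 \<and>
      num_points w ((\<lambda>k. real k / 2) ` {1..<L}) x = 0) \<and> num_points w {0} x = 1) =
    omega (L + 1) + omega (L - 1) - 2 * omega L"
proof -
  let ?X = "\<lambda>i x. occupied w (real i / 2) x"
  let ?Z = "\<lambda>A x. \<Prod>i\<in>A. 1 - ?X i x"
  let ?gap = "\<lambda>x. (num_points w {real L / 2} x = 1 \<and>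
      num_points w ((\<lambda>k. real k / 2) ` {1..<L}) x = 0) \<and> num_points w {0} x = 1"
  have half: "real i / 2 \<in> half_integers" for i
    unfolding half_integers_def by (rule range_eqI[of _ _ "int i"]) simp
  have int_Z: "integrable M (?Z A)" for A
    using integrable_occupied_pattern[where A = "{}" and B = A and g = "\<lambda>i. real i / 2"] by simp
  have meas: "Measurable.pred M ?gap"
    by (intro pred_intros_logic(3) num_points_eq_measurable borel_closed finite_imp_closed finite_imageI) auto
  \<comment> \<open>Inclusion-exclusion over the two endpoints 0 and \<open>L\<close>, distinct
    since \<open>L\<close> is positive. It leaves empty runs of lengths \<open>L - 1\<close>,
    \<open>L\<close>, \<open>L\<close> and \<open>L + 1\<close>, written as
    \<open>{s..<s + n}\<close> to match \<open>expectation_empty_interval\<close>.\<close>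
  have split: "?Z {1..<L} x * ?X 0 x * ?X L x =
      ?Z {1..<1 + (L - 1)} x - ?Z {0..<0 + L} x - ?Z {1..<1 + L} x + ?Z {0..<0 + (L + 1)} x" for x
  proof -
    have "{0..<L} = insert 0 {1..<L}" "{1..<1 + L} = insert L {1..<L}"
      "{0..<L + 1} = insert 0 (insert L {1..<L})" using assms by auto
    thus ?thesis using assms by (simp add: algebra_simps)
  qed
  have "\<P>(x in M. ?gap x) = expectation (indicator {x \<in> space M. ?gap x})"
    by (auto intro!: arg_cong[where f = prob])
  also have "\<dots> = expectation (\<lambda>x. ?Z {1..<L} x * ?X 0 x * ?X L x)"
  proof (rule integral_cong_AE)
    have "AE x in M. num_points w ((\<lambda>k. real k / 2) ` {1..<L}) x = 0 \<longleftrightarrow>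
        (\<forall>c\<in>(\<lambda>k. real k / 2) ` {1..<L}. occupied w c x = 0)"
      by (rule num_points_finite_AE) simp
    with num_points_singleton_AE[OF half[of L]] num_points_singleton_AE[OF half[of 0]] AE_space
    show "AE x in M. indicator {x \<in> space M. ?gap x} x = ?Z {1..<L} x * ?X 0 x * ?X L x"
    proof eventually_elim
      case (elim x)
      have X01: "?X i x = 0 \<or> ?X i x = 1" for i by (auto simp: occupied_def)
      have "?Z {1..<L} x = of_bool (\<forall>i\<in>{1..<L}. ?X i x = 0)"
      proof (cases "\<forall>i\<in>{1..<L}. ?X i x = 0")
        case False
        then obtain i where "i \<in> {1..<L}" "?X i x = 1" using X01 by blast
        hence "?Z {1..<L} x = 0" by (intro prod_zero) auto
        with False show ?thesis by simp
      qed simp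
      moreover have "num_points w {real L / 2} x = 1 \<longleftrightarrow> ?X L x = 1"
        "num_points w {0} x = 1 \<longleftrightarrow> ?X 0 x = 1"
        using elim by auto
      ultimately show ?case
        using elim X01[of L] X01[of 0] by (auto simp: indicator_def)
    qed
  qed (use meas in \<open>auto simp: pred_def\<close>)
  also have "\<dots> = expectation (\<lambda>x. ?Z {1..<1 + (L - 1)} x - ?Z {0..<0 + L} x -
      ?Z {1..<1 + L} x + ?Z {0..<0 + (L + 1)} x)"
    by (simp only: split)
  also have "\<dots> = expectation (?Z {1..<1 + (L - 1)}) - expectation (?Z {0..<0 + L}) -
      expectation (?Z {1..<1 + L}) + expectation (?Z {0..<0 + (L + 1)})"
    by (simp only: Bochner_Integration.integral_add Bochner_Integration.integral_diff
        Bochner_Integration.integrable_add Bochner_Integration.integrable_diff int_Z)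
  also have "\<dots> = omega (L + 1) + omega (L - 1) - 2 * omega L"
    unfolding expectation_empty_interval by simp
  finally show ?thesis .
qed

end

theorem theoremB1:
  fixes M :: "'a measure" and w :: "int \<Rightarrow> 'a \<Rightarrow> real" and L :: nat
  assumes "half_discrete_sine_process M w"
    and "L \<ge> 1"
  shows "gap_prob M w L = 2 * (omega (L + 1) + omega (L - 1) - 2 * omega L)"
proof -
  interpret half_discrete_sine_process M w by fact
  show ?thesis
    \<comment> \<open>The factor 2 is the inverse of the probability 1/2 that 0 is occupied.\<close>
    unfolding gap_prob_def cond_prob_def prob_gap[OF assms(2)] prob_num_points_zero by simp
qed

end
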